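(* Let $A, E\in\mathbb{C}^{n\times n}$ with $E$ invertible and Hermitian, and let $\mathrm{ind}(A)=k$. If $m$ is any positive integer satisfying $m\geq k$ and the set $A^m\{1,3^E\}$ is non-empty, then the $E$-weighted core-EP inverse $A^{\mathrm{ep},E}$ exists and $$A^{\mathrm{ep},E}=A^DA^mX,$$ where $X$ is a $\{1,3^E\}$-inverse of $A^m$.
   Context: The index $\mathrm{ind}(A)$ is the smallest non-negative integer $k$ with $\mathrm{rank}(A^k)=\mathrm{rank}(A^{k+1})$ (with $A^0=I$). $A^D$ is the Drazin inverse of $A$: the unique $X$ with $XA^{k+1}=A^k$, $XAX=X$, $AX=XA$. For a square matrix $B$, $B\{1,3^E\}$ is the set of matrices $Y$ (called $\{1,3^E\}$-inverses of $B$) with $BYB=B$ and $(EBY)^*=EBY$. For $\mathrm{ind}(A)=k$ and $E$ invertible Hermitian, a matrix $X\in\mathbb{C}^{n\times n}$ is called the $E$-weighted core-EP inverse of $A$, denoted $A^{\mathrm{ep},E}$, if $XA^{k+1}=A^k$, $AX^2=X$, and $(EAX)^*=EAX$; such an $X$ is unique when it exists. *)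

theory Defs
  imports "HOL-Analysis.Analysis"
begin

text \<open>The library instance of multiplication on vectors is componentwise, so the overloaded
  power operation is not the matrix power.\<close>

primrec mat_pow :: "'a::semiring_1^'n^'n \<Rightarrow> nat \<Rightarrow> 'a^'n^'n" where
  "mat_pow A 0 = mat 1"
| "mat_pow A (Suc k) = A ** mat_pow A k"

definition conj_transpose :: "complex^'n^'m \<Rightarrow> complex^'m^'n" where
  "conj_transpose A = map_matrix cnj (transpose A)"

definition hermitian :: "complex^'n^'n \<Rightarrow> bool" where
  "hermitian A \<longleftrightarrow> conj_transpose A = A"

definition mat_index :: "complex^'n^'n \<Rightarrow> nat" where
  "mat_index A = (LEAST k. rank (mat_pow A k) = rank (mat_pow A (k + 1)))"

definition is_drazin_inverse :: "complex^'n^'n \<Rightarrow> complex^'n^'n \<Rightarrow> bool" where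
  "is_drazin_inverse A X \<longleftrightarrow>
     X ** mat_pow A (mat_index A + 1) = mat_pow A (mat_index A) \<and>
     X ** A ** X = X \<and>
     A ** X = X ** A"

definition drazin_inverse :: "complex^'n^'n \<Rightarrow> complex^'n^'n" where
  "drazin_inverse A = (THE X. is_drazin_inverse A X)"

definition weighted_13_inverses :: "complex^'n^'n \<Rightarrow> complex^'n^'n \<Rightarrow> (complex^'n^'n) set" where
  "weighted_13_inverses E B = {Y. B ** Y ** B = B \<and> hermitian (E ** B ** Y)}"

definition is_weighted_core_EP_inverse ::
    "complex^'n^'n \<Rightarrow> complex^'n^'n \<Rightarrow> complex^'n^'n \<Rightarrow> bool" where
  "is_weighted_core_EP_inverse E A X \<longleftrightarrow>
     X ** mat_pow A (mat_index A + 1) = mat_pow A (mat_index A) \<and>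
     A ** mat_pow X 2 = X \<and>
     hermitian (E ** A ** X)"

text \<open>Meaningful only if such an inverse exists; for invertible Hermitian weights it is then
  unique by \<open>weighted_core_EP_inverse_unique\<close> below.\<close>

definition weighted_core_EP_inverse ::
    "complex^'n^'n \<Rightarrow> complex^'n^'n \<Rightarrow> complex^'n^'n" where
  "weighted_core_EP_inverse E A = (THE X. is_weighted_core_EP_inverse E A X)"


subsection \<open>Well-definedness\<close>

lemma mat_pow_add: "mat_pow A (i + j) = mat_pow A i ** mat_pow A j"
  by (induction i) (simp_all add: matrix_mul_assoc)

lemma mat_pow_Suc_right: "mat_pow A (Suc j) = mat_pow A j ** A"
  using mat_pow_add[of A j 1] by simp

lemma mat_pow_commute:
  assumes "A ** X = X ** A"
  shows "mat_pow A i ** mat_pow X j = mat_pow X j ** mat_pow A i"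
proof -
  have "A ** mat_pow X j = mat_pow X j ** A"
    using assms by (induction j) (simp, simp, metis matrix_mul_assoc)
  then show ?thesis
    by (induction i) (simp, simp, metis matrix_mul_assoc)
qed

lemma conj_transpose_mult: "conj_transpose (A ** B) = conj_transpose B ** conj_transpose A"
  by (simp add: conj_transpose_def vec_eq_iff matrix_matrix_mult_def transpose_def mult.commute)

lemma pow_mult_shift:
  assumes "A ** X ** X = X"
  shows "mat_pow A j ** mat_pow X (Suc j) = X"
proof (induction j)
  case (Suc j)
  have "mat_pow A (Suc j) ** mat_pow X (Suc (Suc j)) = A ** (mat_pow A j ** mat_pow X (Suc j)) ** X"
    by (simp only: mat_pow.simps(2)[of A] mat_pow_Suc_right[of X "Suc j"] matrix_mul_assoc)
  then show ?case using Suc assms by simp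
qed simp

lemma weighted_core_EP_inverse_unique:
  assumes E: "invertible E" "hermitian E"
    and X: "is_weighted_core_EP_inverse E A X" and Y: "is_weighted_core_EP_inverse E A Y"
  shows "X = Y"
proof -
  define k where "k = mat_index A"
  have absorb: "U ** A ** V = V" "A ** U ** (A ** V) = A ** V"
    if "U ** mat_pow A (k + 1) = mat_pow A k" "A ** mat_pow V 2 = V" for U V
  proof -
    have V: "mat_pow A k ** mat_pow V (Suc k) = V"
      using that(2) pow_mult_shift[of A V k] by (simp add: numeral_2_eq_2 matrix_mul_assoc)
    have "U ** A ** V = U ** mat_pow A (k + 1) ** mat_pow V (Suc k)"
      by (subst V[symmetric]) (simp add: matrix_mul_assoc)
    then show *: "U ** A ** V = V"
      using that(1) V by simp
    have "A ** U ** (A ** V) = A ** (U ** A ** V)"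
      by (simp add: matrix_mul_assoc)
    then show "A ** U ** (A ** V) = A ** V" using * by simp
  qed
  note x = X[unfolded is_weighted_core_EP_inverse_def, folded k_def]
  note y = Y[unfolded is_weighted_core_EP_inverse_def, folded k_def]
  define P where "P = A ** X"
  define Q where "Q = A ** Y"
  have PQ: "P ** Q = Q" and QP: "Q ** P = P"
    unfolding P_def Q_def using absorb(2) x y by blast+
  have EP: "conj_transpose P ** E = E ** P" and EQ: "conj_transpose Q ** E = E ** Q"
    using x y E(2) unfolding P_def Q_def hermitian_def
    by (metis conj_transpose_mult matrix_mul_assoc)+
  have "E ** Q = conj_transpose P ** E ** Q"
    by (metis EP PQ matrix_mul_assoc)
  also have "\<dots> = conj_transpose (Q ** P) ** E"
    by (metis EQ conj_transpose_mult matrix_mul_assoc)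
  also have "\<dots> = E ** P"
    using EP QP by simp
  finally have "E ** Q = E ** P" .
  with E(1) have "P = Q"
    unfolding invertible_def by (metis matrix_mul_assoc matrix_mul_lid)
  have "X = X ** (A ** X)"
    using absorb(1)[of X X] x by (simp add: matrix_mul_assoc)
  also have "\<dots> = X ** A ** Y"
    using \<open>P = Q\<close> by (simp add: P_def Q_def matrix_mul_assoc)
  also have "\<dots> = Y"
    using absorb(1) x y by blast
  finally show ?thesis .
qed

lemma row_span_factor:
  fixes B C :: "'a::field^'n^'n"
  assumes "rows B \<subseteq> vec.span (rows C)"
  shows "\<exists>Z. B = Z ** C"
proof -
  have "\<exists>z. row i B = (\<Sum>j\<in>UNIV. z j *s row j C)" for i
  proof -
    have "row i B \<in> vec.span (range (\<lambda>j. row j C))"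
      using assms by (auto simp: rows_def full_SetCompr_eq)
    then show ?thesis
    proof (induction rule: vec.span_induct_alt)
      case base
      show ?case by (intro exI[of _ "\<lambda>_. 0"]) simp
    next
      case (step c x y)
      then obtain z j where "y = (\<Sum>j\<in>UNIV. z j *s row j C)" "x = row j C" by auto
      then have "c *s x + y = (\<Sum>i\<in>UNIV. (z i + (if i = j then c else 0)) *s row i C)"
        by (simp add: vec.scale_left_distrib sum.distrib if_distrib[of "\<lambda>a. a *s _"] cong: if_cong)
      then show ?case by (intro exI[of _ "\<lambda>i. z i + (if i = j then c else 0)"])
    qed
  qed
  then obtain z where z: "\<And>i. row i B = (\<Sum>j\<in>UNIV. z i j *s row j C)" by metis
  have "B = (\<chi> i j. z i j) ** C"
  proof (simp add: vec_eq_iff matrix_matrix_mult_def, intro allI)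
    fix i l
    have "row i B $ l = (\<Sum>j\<in>UNIV. z i j *s row j C) $ l" using z by simp
    then show "B $ i $ l = (\<Sum>j\<in>UNIV. z i j * C $ j $ l)" by (simp add: row_def)
  qed
  then show ?thesis by blast
qed

lemma rows_mult_subset:
  fixes B C :: "'a::field^'n^'n"
  shows "rows (B ** C) \<subseteq> vec.span (rows C)"
proof -
  have "row i (B ** C) = (\<Sum>j\<in>UNIV. B $ i $ j *s row j C)" for i
    by (simp add: vec_eq_iff row_def matrix_matrix_mult_def)
  moreover have "row j C \<in> rows C" for j by (auto simp: rows_def)
  ultimately have "row i (B ** C) \<in> vec.span (rows C)" for i
    by (simp add: vec.span_sum vec.span_scale vec.span_base)
  then show ?thesis by (auto simp: rows_def[of "B ** C"])
qed

lemma rank_mult_le_gen: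
  fixes B C :: "'a::field^'n^'n"
  shows "rank (B ** C) \<le> rank C"
  unfolding row_rank_def_gen
  using vec.dim_mono[OF rows_mult_subset] by blast

lemma rank_pow_stable_ex:
  fixes A :: "'a::field^'n^'n"
  shows "\<exists>k. rank (mat_pow A k) = rank (mat_pow A (k + 1))"
proof -
  obtain k where k: "\<And>j. rank (mat_pow A k) \<le> rank (mat_pow A j)"
    using ex_has_least_nat[of "\<lambda>_. True" 0 "\<lambda>j. rank (mat_pow A j)"] by auto
  then show ?thesis
    using rank_mult_le_gen[of A "mat_pow A k"] k[of "Suc k"]
    by (intro exI[of _ k]) (simp add: le_antisym)
qed

lemma rank_pow_stable_left:
  fixes A :: "'a::field^'n^'n"
  assumes "rank (mat_pow A k) = rank (mat_pow A (k + 1))"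
  shows "\<exists>Z. mat_pow A k = Z ** mat_pow A (k + 1)"
proof (rule row_span_factor)
  have "vec.span (rows (mat_pow A (k + 1))) = vec.span (rows (mat_pow A k))"
    using assms rows_mult_subset[of A "mat_pow A k"] unfolding row_rank_def_gen
    by (intro vec.subspace_dim_equal)
      (auto simp: vec.span_minimal intro: vec.subspace_span dest: subsetD[OF vec.span_minimal])
  then show "rows (mat_pow A k) \<subseteq> vec.span (rows (mat_pow A (k + 1)))"
    using vec.span_superset by blast
qed

lemma rank_mat_index: "rank (mat_pow A (mat_index A)) = rank (mat_pow A (mat_index A + 1))"
  unfolding mat_index_def by (rule LeastI_ex[OF rank_pow_stable_ex])

lemma transpose_mat_pow: "transpose (mat_pow (A::'a::comm_semiring_1^'n^'n) k) = mat_pow (transpose A) k"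
proof (induction k)
  case (Suc k)
  show ?case
    by (simp only: mat_pow.simps(2)[of A] matrix_transpose_mul Suc
        mat_pow_Suc_right[of "transpose A"])
qed (simp add: transpose_mat)

lemma drazin_inverse_ex1:
  shows "\<exists>!X. is_drazin_inverse A X"
proof -
  define k where "k = mat_index A"
  define P where "P = mat_pow A"
  have comm: "P i ** P j = P (i + j)" for i j by (simp add: P_def mat_pow_add)
  have P1: "P 1 = A" by (simp add: P_def)
  obtain Z where Z: "P k = Z ** P (k + 1)"
    using rank_pow_stable_left[OF rank_mat_index] unfolding k_def P_def by blast
  have Zj: "P k = mat_pow Z j ** P (k + j)" for j
  proof (induction j)
    case (Suc j)
    have "mat_pow Z (Suc j) ** P (k + Suc j) = mat_pow Z j ** (Z ** P (k + 1) ** P j)"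
      by (simp add: mat_pow_Suc_right comm del: mat_pow.simps flip: matrix_mul_assoc)
    also have "\<dots> = P k" by (simp only: Z[symmetric] comm Suc[symmetric])
    finally show ?case by simp
  qed simp
  obtain j where "rank (mat_pow (transpose A) j) = rank (mat_pow (transpose A) (j + 1))"
    using rank_pow_stable_ex by blast
  then obtain W where "mat_pow (transpose A) j = W ** mat_pow (transpose A) (j + 1)"
    using rank_pow_stable_left by blast
  then have "P j = P (j + 1) ** transpose W"
    unfolding P_def by (metis transpose_mat_pow matrix_transpose_mul transpose_transpose)
  then obtain V where Vj0: "P j = P (j + 1) ** V" by blast
  have "P k = mat_pow Z j ** P k ** P j"
    using Zj[of j] by (metis comm matrix_mul_assoc)
  also have "\<dots> = mat_pow Z j ** P (k + j) ** (P 1 ** V)"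
    by (subst Vj0) (simp only: comm[symmetric] matrix_mul_assoc)
  also have "\<dots> = P (k + 1) ** V"
    by (simp add: comm matrix_mul_assoc flip: Zj)
  finally have V: "P k = P (k + 1) ** V" .
  have Vj: "P k = P (k + i) ** mat_pow V i" for i
  proof (induction i)
    case (Suc i)
    have "P (k + Suc i) ** mat_pow V (Suc i) = P i ** (P (k + 1) ** V) ** mat_pow V i"
      by (simp add: comm matrix_mul_assoc add.commute)
    also have "\<dots> = P k"
      by (simp only: V[symmetric] comm add.commute[of i k] Suc[symmetric])
    finally show ?case by simp
  qed (simp add: matrix_mul_rid)
  have swap: "P k ** mat_pow V i = mat_pow Z i ** P k" for i
    using Zj[of i] Vj[of i] by (metis matrix_mul_assoc)
  define X where "X = P k ** mat_pow V (k + 1)"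
  have X: "X = mat_pow Z (k + 1) ** P k"
    by (simp only: X_def swap)
  have AX: "A ** X = P k ** mat_pow V k"
  proof -
    have "A ** X = P (1 + k) ** (V ** mat_pow V k)"
      by (simp add: X_def matrix_mul_assoc P_def)
    also have "\<dots> = P k ** mat_pow V k"
      by (metis V add.commute matrix_mul_assoc)
    finally show ?thesis .
  qed
  have XA: "X ** A = mat_pow Z k ** P k"
  proof -
    have "X ** A = mat_pow Z k ** Z ** (P k ** P 1)"
      by (simp only: X Suc_eq_plus1[symmetric] mat_pow_Suc_right P1 matrix_mul_assoc)
    also have "\<dots> = mat_pow Z k ** P k"
      by (metis Z comm matrix_mul_assoc)
    finally show ?thesis .
  qed
  have "is_drazin_inverse A X"
    unfolding is_drazin_inverse_def k_def[symmetric] P_def[symmetric]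
  proof (intro conjI)
    show XP: "X ** P (k + 1) = P k"
    proof -
      have "X ** P (k + 1) = mat_pow Z (k + 1) ** (P k ** P (k + 1))"
        by (simp only: X matrix_mul_assoc)
      also have "\<dots> = P k"
        by (simp only: comm Zj[symmetric])
      finally show ?thesis .
    qed
    show "A ** X = X ** A" by (simp only: AX XA swap)
    have "X ** A ** X = X ** (P 1 ** P k) ** mat_pow V (k + 1)"
      by (simp only: X_def P1 matrix_mul_assoc)
    also have "\<dots> = X"
      using XP by (simp only: comm X_def add.commute)
    finally show "X ** A ** X = X" .
  qed
  moreover have "X = Y" if X: "is_drazin_inverse A X" and Y: "is_drazin_inverse A Y" for X Y
  proof -
    note x = X[unfolded is_drazin_inverse_def, folded k_def P_def]
    note y = Y[unfolded is_drazin_inverse_def, folded k_def P_def]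
    have x1: "X = mat_pow X (Suc k) ** P k"
      using pow_mult_shift[of A X k] x mat_pow_commute[of A X k "Suc k"] by (simp add: P_def)
    have y1: "Y = P k ** mat_pow Y (Suc k)"
      using pow_mult_shift[of A Y k] y by (simp add: P_def)
    have y2: "P (k + 1) ** Y = P k"
      using y mat_pow_commute[of A Y "k + 1" 1] by (simp add: P_def)
    have "X ** A ** Y = X ** (P 1 ** P k) ** mat_pow Y (Suc k)"
      by (subst y1) (simp only: P1 matrix_mul_assoc)
    also have "\<dots> = Y"
      using x y1 by (metis comm add.commute)
    finally have 1: "X ** A ** Y = Y" .
    have "X ** A ** Y = mat_pow X (Suc k) ** (P k ** P 1 ** Y)"
      by (subst x1) (simp only: P1 matrix_mul_assoc)
    also have "\<dots> = X"
      using x1 y2 by (simp only: comm)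
    finally show ?thesis using 1 by simp
  qed
  ultimately show ?thesis by blast
qed

end

theory Submission
  imports Defs
begin

text \<open>Put \<open>Z = A\<^sup>D A\<^sup>m X\<close>. Since \<open>A\<^sup>D\<close> cancels one factor \<open>A\<close> from powers beyond the index,
  \<open>A Z = A\<^sup>m X\<close>; as \<open>A\<^sup>m X\<close> fixes the range of \<open>A\<^sup>m\<close>, which contains the columns of \<open>Z\<close> and of
  every \<open>A\<^sup>j\<close> with \<open>j\<close> at least the index, the defining equations of the core-EP inverse follow.\<close>

lemma is_drazin_inverse_drazin_inverse: "is_drazin_inverse A (drazin_inverse A)"
  unfolding drazin_inverse_def by (rule theI'[OF drazin_inverse_ex1])

lemma weighted_core_EP_inverse_eqI:
  assumes "invertible E" "hermitian E" "is_weighted_core_EP_inverse E A X"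
  shows "weighted_core_EP_inverse E A = X"
  unfolding weighted_core_EP_inverse_def
  using assms weighted_core_EP_inverse_unique by blast

text \<open>The defining equation of \<open>D\<close> covers only the exponent
  \<open>mat_index A + 1\<close>; splitting off the surplus factor
  \<open>mat_pow A (j - mat_index A)\<close> on the right carries it to higher exponents.\<close>

lemma drazin_mult_mat_pow_Suc:
  assumes "is_drazin_inverse A D" and "mat_index A \<le> j"
  shows "D ** mat_pow A (Suc j) = mat_pow A j"
proof -
  let ?k = "mat_index A"
  have "D ** mat_pow A (Suc j) = D ** mat_pow A (?k + 1) ** mat_pow A (j - ?k)"
    using assms(2) by (simp flip: matrix_mul_assoc mat_pow_add del: mat_pow.simps)
  also have "\<dots> = mat_pow A ?k ** mat_pow A (j - ?k)"
    using assms(1) by (simp add: is_drazin_inverse_def)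
  also have "\<dots> = mat_pow A j"
    using assms(2) by (simp flip: mat_pow_add)
  finally show ?thesis .
qed

text \<open>Exhibits \<open>mat_pow A j\<close> as a left multiple by \<open>mat_pow A i\<close>, so
  its columns lie in the range of \<open>mat_pow A i\<close> even when i > j.\<close>

lemma mat_pow_mult_drazin_pow:
  assumes "is_drazin_inverse A D" and "mat_index A \<le> j"
  shows "mat_pow A i ** mat_pow D i ** mat_pow A j = mat_pow A j"
proof -
  have "A ** D = D ** A"
    using assms(1) by (simp add: is_drazin_inverse_def)
  note comm = mat_pow_commute[OF this]
  \<comment> \<open>Each step cancels the innermost \<open>D\<close>; the exponent left over,
    \<open>i + j\<close>, never drops below the index.\<close>
  have "mat_pow D i ** mat_pow A (i + j) = mat_pow A j"
  proof (induction i)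
    case (Suc i)
    have "mat_pow D (Suc i) ** mat_pow A (Suc i + j)
        = mat_pow D i ** (D ** mat_pow A (Suc (i + j)))"
      by (simp only: mat_pow_Suc_right[of D] add_Suc matrix_mul_assoc)
    then show ?case
      using Suc drazin_mult_mat_pow_Suc[OF assms(1), of "i + j"] assms(2) by simp
  qed simp
  then show ?thesis
    by (simp add: comm mat_pow_add matrix_mul_assoc)
qed

lemma is_weighted_core_EP_inverse_drazin:
  assumes D: "is_drazin_inverse A D" and m: "mat_index A \<le> m"
    and X: "X \<in> weighted_13_inverses E (mat_pow A m)"
  shows "is_weighted_core_EP_inverse E A (D ** mat_pow A m ** X)"
proof -
  define k where "k = mat_index A"
  define P where "P = mat_pow A m"
  define Z where "Z = D ** P ** X"
  have inner: "P ** X ** P = P" and herm: "hermitian (E ** P ** X)"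
    using X by (simp_all add: weighted_13_inverses_def P_def)
  have AD: "A ** D = D ** A"
    using D by (simp add: is_drazin_inverse_def)
  have PD: "P ** D = D ** P"
    using mat_pow_commute[OF AD, of m 1] by (simp add: P_def)
  have AZ: "A ** Z = P ** X"
  proof -
    have "A ** Z = D ** mat_pow A (Suc m) ** X"
      by (simp add: Z_def P_def AD matrix_mul_assoc)
    then show ?thesis
      using drazin_mult_mat_pow_Suc[OF D m] by (simp add: P_def)
  qed
  have "Z ** mat_pow A (k + 1) = mat_pow A k"
  proof -
    \<comment> \<open>Since \<open>m\<close> may exceed \<open>k + 1\<close>, the factor
      \<open>P\<close> is created on the left here, so that \<open>P ** X ** P = P\<close> can
      absorb \<open>X\<close>.\<close>
    have A: "mat_pow A (k + 1) = P ** mat_pow D m ** mat_pow A (k + 1)"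
      using mat_pow_mult_drazin_pow[OF D, of "k + 1" m] by (simp add: P_def k_def)
    have "Z ** mat_pow A (k + 1) = D ** (P ** X ** P) ** mat_pow D m ** mat_pow A (k + 1)"
      by (subst A) (simp only: Z_def matrix_mul_assoc)
    also have "\<dots> = D ** (P ** mat_pow D m ** mat_pow A (k + 1))"
      by (simp only: inner matrix_mul_assoc)
    also have "\<dots> = mat_pow A k"
      using drazin_mult_mat_pow_Suc[OF D, of k] A by (simp add: k_def)
    finally show ?thesis .
  qed
  moreover have "A ** mat_pow Z 2 = Z"
  proof -
    have "A ** mat_pow Z 2 = P ** X ** Z"
      by (simp add: numeral_2_eq_2 matrix_mul_assoc AZ)
    \<comment> \<open>Moving \<open>D\<close> to the right of \<open>P\<close> brings
      \<open>P\<close> next to \<open>P ** X\<close>.\<close>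
    also have "\<dots> = P ** X ** P ** D ** X"
      by (simp only: Z_def PD[symmetric] matrix_mul_assoc)
    also have "\<dots> = Z"
      by (simp add: inner PD Z_def)
    finally show ?thesis .
  qed
  \<comment> \<open>By \<open>AZ\<close> this is the second condition on \<open>X\<close>.\<close>
  moreover have "hermitian (E ** A ** Z)"
    using herm AZ by (simp flip: matrix_mul_assoc)
  ultimately show ?thesis
    by (simp add: is_weighted_core_EP_inverse_def Z_def P_def k_def)
qed

theorem theorem3p13:
  fixes A E :: "complex^'n^'n" and k m :: nat
  assumes "invertible E" and "hermitian E"
    and "mat_index A = k"
    and "m > 0" and "m \<ge> k"
    and "weighted_13_inverses E (mat_pow A m) \<noteq> {}"
  shows "(\<exists>Z. is_weighted_core_EP_inverse E A Z) \<and>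
    (\<forall>X \<in> weighted_13_inverses E (mat_pow A m).
       weighted_core_EP_inverse E A = drazin_inverse A ** mat_pow A m ** X)"
proof -
  have *: "is_weighted_core_EP_inverse E A (drazin_inverse A ** mat_pow A m ** X)"
    if "X \<in> weighted_13_inverses E (mat_pow A m)" for X
    using is_weighted_core_EP_inverse_drazin[OF is_drazin_inverse_drazin_inverse _ that]
      assms(3,5) by simp
  show ?thesis
    using * assms(6) weighted_core_EP_inverse_eqI[OF assms(1,2)] by blast
qed

end
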